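(* Fix a run size $k\ge1$ and a nonempty finite workflow pool $\mathcal M$. Suppose $\psi_k$ is nondecreasing and discrete concave, i.e. $d_{1,k}\ge d_{2,k}\ge\cdots\ge d_{k,k}\ge0$, and $d_{1,k}>0$. Let $z=(z_g)_{g\in\mathcal M}$ be any feasible fractional execution vector ($z_g\ge0$, $\sum_{g}z_g=k$), and let $\boldsymbol M_k^{\mathrm{RR}}(z)$ be the random size-$k$ execution-count vector obtained by with-replacement rounding. Then $$\mathbb E\big[\Pi_{\psi,\gamma}(\boldsymbol M_k^{\mathrm{RR}}(z))\big]\ge\Big(1-\frac1e\Big)Q_k(z)+\frac{d_{k,k}}{e}R_k(z)-\gamma C_k(z),$$ $$F_k(z)-\mathbb E\big[\Pi_{\psi,\gamma}(\boldsymbol M_k^{\mathrm{RR}}(z))\big]\le\frac1e\big\{Q_k(z)-d_{k,k}R_k(z)\big\}\le\frac{c_{\psi,k}}{e}Q_k(z).$$ In particular, if $z=z^{k\star}$ is an optimal solution of the size-$k$ LP (a maximizer of $F_k$ over $\{z\ge0:\sum_gz_g=k\}$), and $Q_k^\star=Q_k(z^{k\star})$, $R_k^\star=R_k(z^{k\star})$, $\boldsymbol M_k^{\mathrm{RR}}=\boldsymbol M_k^{\mathrm{RR}}(z^{k\star})$, then $$\mathrm{OPT}_k(\mathcal M)-\mathbb E\big[\Pi_{\psi,\gamma}(\boldsymbol M_k^{\mathrm{RR}})\big]\le\frac1e\big(Q_k^\star-d_{k,k}R_k^\star\big)\le\frac{c_{\psi,k}}{e}Q_k^\star.$$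
   Context: Setting. There are $n\ge1$ tasks $i=1,\dots,n$, workflow types $g\in\mathcal M$, correctness indicators $a_{ig}\in\{0,1\}$, costs $c_g\ge0$, cost price $\gamma\ge0$. The recovery curve $\psi_k:\{0,\dots,k\}\to[0,1]$ satisfies $\psi_k(0)=0$, $\psi_k(k)=1$; $d_{\ell,k}=\psi_k(\ell)-\psi_k(\ell-1)$; curvature $c_{\psi,k}=1-d_{k,k}/d_{1,k}$. For $\boldsymbol m\in\mathbb Z_+^{\mathcal M}$ with $\sum_gm_g=k$: $r_i(\boldsymbol m)=\sum_ga_{ig}m_g$, $C(\boldsymbol m)=\sum_gc_gm_g$, $\Pi_{\psi,\gamma}(\boldsymbol m)=\frac1n\sum_i\psi_k(r_i(\boldsymbol m))-\gamma C(\boldsymbol m)$, and $\mathrm{OPT}_k(\mathcal M)$ is the maximum of $\Pi_{\psi,\gamma}$ over such $\boldsymbol m$. Extended curve: $\widetilde\psi_k(r)=d_{k,k}r+\sum_{t=1}^{k-1}(d_{t,k}-d_{t+1,k})\min\{r,t\}$ for real $r\ge0$ (it agrees with $\psi_k$ at integers $0,\dots,k$). For $z\ge0$ with $\sum_gz_g=k$: $x_i(z)=\sum_ga_{ig}z_g$, $Q_k(z)=\frac1n\sum_i\widetilde\psi_k(x_i(z))$, $R_k(z)=\frac1n\sum_ix_i(z)$, $C_k(z)=\sum_gc_gz_g$, $F_k(z)=Q_k(z)-\gamma C_k(z)$. The size-$k$ LP is: maximize $\frac1n\sum_i\sum_{\ell=1}^kd_{\ell,k}y_{i\ell}-\gamma\sum_gc_gz_g$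 subject to $\sum_\ell y_{i\ell}\le\sum_ga_{ig}z_g$, $y_{i\ell}\le y_{i,\ell-1}$ ($\ell\ge2$), $\sum_gz_g=k$, $z_g\ge0$, $0\le y_{i\ell}\le1$; optimizing out $y$, it is the maximization of $F_k$ over $\{z\ge0:\sum_gz_g=k\}$. With-replacement rounding: draw $G_1,\dots,G_k$ i.i.d. with $\Pr(G_j=g)=z_g/k$ and let $\boldsymbol M_k^{\mathrm{RR}}(z)$ have components $M_{k,g}^{\mathrm{RR}}(z)=\sum_{j=1}^k\mathbf 1\{G_j=g\}$. *)

theory Defs
  imports "HOL-Probability.Probability"
begin

text \<open>
  Conventions: tasks are the indices in \<open>{1..n}\<close>, the workflow pool is a finite set \<open>M\<close> of
  elements of an arbitrary type, \<open>a i g\<close> is the correctness indicator, and \<open>psi\<close> is the recovery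
  curve for the run size \<open>k\<close>, of which only the values on \<open>{0..k}\<close> are relevant. Execution vectors
  are functions on the type of workflows of which only the values on \<open>M\<close> are relevant.
\<close>

definition incr :: "(nat \<Rightarrow> real) \<Rightarrow> nat \<Rightarrow> real" where
  "incr psi l = psi l - psi (l - 1)"

definition curvature :: "(nat \<Rightarrow> real) \<Rightarrow> nat \<Rightarrow> real" where
  "curvature psi k = 1 - incr psi k / incr psi 1"

definition ext_curve :: "(nat \<Rightarrow> real) \<Rightarrow> nat \<Rightarrow> real \<Rightarrow> real" where
  "ext_curve psi k r =
     incr psi k * r + (\<Sum>t = 1..<k. (incr psi t - incr psi (t + 1)) * min r (real t))"


subsection \<open>Integral execution counts\<close>

text \<open>Count vectors are normalised to vanish outside \<open>M\<close>, which makes them a finite set.\<close>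

definition count_vectors :: "'g set \<Rightarrow> nat \<Rightarrow> ('g \<Rightarrow> nat) set" where
  "count_vectors M k = {m. (\<forall>g. g \<notin> M \<longrightarrow> m g = 0) \<and> (\<Sum>g\<in>M. m g) = k}"

definition num_correct :: "'g set \<Rightarrow> (nat \<Rightarrow> 'g \<Rightarrow> nat) \<Rightarrow> nat \<Rightarrow> ('g \<Rightarrow> nat) \<Rightarrow> nat" where
  "num_correct M a i m = (\<Sum>g\<in>M. a i g * m g)"

definition profit ::
  "nat \<Rightarrow> 'g set \<Rightarrow> (nat \<Rightarrow> 'g \<Rightarrow> nat) \<Rightarrow> ('g \<Rightarrow> real) \<Rightarrow> real \<Rightarrow> (nat \<Rightarrow> real) \<Rightarrow> ('g \<Rightarrow> nat) \<Rightarrow> real" where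
  "profit n M a c \<gamma> psi m =
     (1 / real n) * (\<Sum>i = 1..n. psi (num_correct M a i m)) - \<gamma> * (\<Sum>g\<in>M. c g * real (m g))"

definition opt_profit ::
  "nat \<Rightarrow> 'g set \<Rightarrow> (nat \<Rightarrow> 'g \<Rightarrow> nat) \<Rightarrow> ('g \<Rightarrow> real) \<Rightarrow> real \<Rightarrow> (nat \<Rightarrow> real) \<Rightarrow> nat \<Rightarrow> real" where
  "opt_profit n M a c \<gamma> psi k = Max (profit n M a c \<gamma> psi ` count_vectors M k)"


subsection \<open>Fractional execution vectors and the linear program\<close>

definition frac_feasible :: "'g set \<Rightarrow> nat \<Rightarrow> ('g \<Rightarrow> real) \<Rightarrow> bool" where
  "frac_feasible M k z \<longleftrightarrow> (\<forall>g\<in>M. 0 \<le> z g) \<and> (\<Sum>g\<in>M. z g) = real k"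

definition frac_correct :: "'g set \<Rightarrow> (nat \<Rightarrow> 'g \<Rightarrow> nat) \<Rightarrow> nat \<Rightarrow> ('g \<Rightarrow> real) \<Rightarrow> real" where
  "frac_correct M a i z = (\<Sum>g\<in>M. real (a i g) * z g)"

definition frac_Q ::
  "nat \<Rightarrow> 'g set \<Rightarrow> (nat \<Rightarrow> 'g \<Rightarrow> nat) \<Rightarrow> (nat \<Rightarrow> real) \<Rightarrow> nat \<Rightarrow> ('g \<Rightarrow> real) \<Rightarrow> real" where
  "frac_Q n M a psi k z = (1 / real n) * (\<Sum>i = 1..n. ext_curve psi k (frac_correct M a i z))"

definition frac_R :: "nat \<Rightarrow> 'g set \<Rightarrow> (nat \<Rightarrow> 'g \<Rightarrow> nat) \<Rightarrow> ('g \<Rightarrow> real) \<Rightarrow> real" where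
  "frac_R n M a z = (1 / real n) * (\<Sum>i = 1..n. frac_correct M a i z)"

definition frac_C :: "'g set \<Rightarrow> ('g \<Rightarrow> real) \<Rightarrow> ('g \<Rightarrow> real) \<Rightarrow> real" where
  "frac_C M c z = (\<Sum>g\<in>M. c g * z g)"

definition frac_F ::
  "nat \<Rightarrow> 'g set \<Rightarrow> (nat \<Rightarrow> 'g \<Rightarrow> nat) \<Rightarrow> ('g \<Rightarrow> real) \<Rightarrow> real \<Rightarrow> (nat \<Rightarrow> real) \<Rightarrow> nat
     \<Rightarrow> ('g \<Rightarrow> real) \<Rightarrow> real" where
  "frac_F n M a c \<gamma> psi k z = frac_Q n M a psi k z - \<gamma> * frac_C M c z"

definition lp_feasible ::
  "nat \<Rightarrow> 'g set \<Rightarrow> (nat \<Rightarrow> 'g \<Rightarrow> nat) \<Rightarrow> nat \<Rightarrow> ('g \<Rightarrow> real) \<Rightarrow> (nat \<Rightarrow> nat \<Rightarrow> real) \<Rightarrow> bool" where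
  "lp_feasible n M a k z y \<longleftrightarrow>
     (\<forall>i\<in>{1..n}. (\<Sum>l = 1..k. y i l) \<le> (\<Sum>g\<in>M. real (a i g) * z g)) \<and>
     (\<forall>i\<in>{1..n}. \<forall>l\<in>{2..k}. y i l \<le> y i (l - 1)) \<and>
     (\<Sum>g\<in>M. z g) = real k \<and>
     (\<forall>g\<in>M. 0 \<le> z g) \<and>
     (\<forall>i\<in>{1..n}. \<forall>l\<in>{1..k}. 0 \<le> y i l \<and> y i l \<le> 1)"

definition lp_objective ::
  "nat \<Rightarrow> 'g set \<Rightarrow> ('g \<Rightarrow> real) \<Rightarrow> real \<Rightarrow> (nat \<Rightarrow> real) \<Rightarrow> nat
     \<Rightarrow> ('g \<Rightarrow> real) \<Rightarrow> (nat \<Rightarrow> nat \<Rightarrow> real) \<Rightarrow> real" where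
  "lp_objective n M c \<gamma> psi k z y =
     (1 / real n) * (\<Sum>i = 1..n. \<Sum>l = 1..k. incr psi l * y i l) - \<gamma> * (\<Sum>g\<in>M. c g * z g)"

definition lp_optimal ::
  "nat \<Rightarrow> 'g set \<Rightarrow> (nat \<Rightarrow> 'g \<Rightarrow> nat) \<Rightarrow> ('g \<Rightarrow> real) \<Rightarrow> real \<Rightarrow> (nat \<Rightarrow> real) \<Rightarrow> nat
     \<Rightarrow> ('g \<Rightarrow> real) \<Rightarrow> (nat \<Rightarrow> nat \<Rightarrow> real) \<Rightarrow> bool" where
  "lp_optimal n M a c \<gamma> psi k z y \<longleftrightarrow>
     lp_feasible n M a k z y \<and>
     (\<forall>z' y'. lp_feasible n M a k z' y' \<longrightarrow>
        lp_objective n M c \<gamma> psi k z' y' \<le> lp_objective n M c \<gamma> psi k z y)"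


subsection \<open>With-replacement rounding\<close>

text \<open>
  The specification of \<open>embed_pmf\<close> applies for feasible \<open>z\<close> and \<open>k > 0\<close>; see \<open>pmf_draw_pmf\<close> below.
\<close>

definition draw_pmf :: "'g set \<Rightarrow> nat \<Rightarrow> ('g \<Rightarrow> real) \<Rightarrow> 'g pmf" where
  "draw_pmf M k z = embed_pmf (\<lambda>g. if g \<in> M then z g / real k else 0)"

text \<open>The joint law of \<open>k\<close> independent draws, pushed forward to the vector of counts.\<close>

definition rounding_pmf :: "'g set \<Rightarrow> nat \<Rightarrow> ('g \<Rightarrow> real) \<Rightarrow> ('g \<Rightarrow> nat) pmf" where
  "rounding_pmf M k z =
     map_pmf (\<lambda>G g. \<Sum>j = 1..k. if G j = g then 1 else 0)
       (Pi_pmf {1..k} undefined (\<lambda>_. draw_pmf M k z))"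

definition expected_profit ::
  "nat \<Rightarrow> 'g set \<Rightarrow> (nat \<Rightarrow> 'g \<Rightarrow> nat) \<Rightarrow> ('g \<Rightarrow> real) \<Rightarrow> real \<Rightarrow> (nat \<Rightarrow> real) \<Rightarrow> nat
     \<Rightarrow> ('g \<Rightarrow> real) \<Rightarrow> real" where
  "expected_profit n M a c \<gamma> psi k z =
     measure_pmf.expectation (rounding_pmf M k z) (profit n M a c \<gamma> psi)"


subsection \<open>Sanity checks\<close>

lemma pmf_draw_pmf:
  assumes "finite M" "k > 0" "frac_feasible M k z"
  shows "pmf (draw_pmf M k z) g = (if g \<in> M then z g / real k else 0)"
  unfolding draw_pmf_def
proof (rule pmf_embed_pmf)
  show "0 \<le> (if x \<in> M then z x / real k else 0)" for x
    using assms by (auto simp: frac_feasible_def)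
  have "(\<integral>\<^sup>+ x. ennreal (if x \<in> M then z x / real k else 0) \<partial>count_space UNIV)
      = (\<Sum>x\<in>M. ennreal (if x \<in> M then z x / real k else 0))"
    using assms(1) by (intro nn_integral_count_space') auto
  also have "\<dots> = ennreal (\<Sum>x\<in>M. z x / real k)"
    using assms by (subst sum_ennreal[symmetric]) (auto simp: frac_feasible_def)
  also have "(\<Sum>x\<in>M. z x / real k) = 1"
    using assms by (simp add: frac_feasible_def flip: sum_divide_distrib)
  finally show "(\<integral>\<^sup>+ x. ennreal (if x \<in> M then z x / real k else 0) \<partial>count_space UNIV) = 1"
    by simp
qed

lemma finite_count_vectors:
  assumes "finite M"
  shows "finite (count_vectors M k)"
proof (rule finite_subset)
  show "count_vectors M k \<subseteq> {m. m ` M \<subseteq> {..k} \<and> {g. m g \<noteq> 0} \<subseteq> M}"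
    using assms by (auto simp: count_vectors_def intro: member_le_sum)
  have "{m. m ` M \<subseteq> {..k} \<and> {g. m g \<noteq> 0} \<subseteq> M}
      = {m. \<forall>g. (g \<in> M \<longrightarrow> m g \<in> {..k}) \<and> (g \<notin> M \<longrightarrow> m g = 0)}"
    by (auto; metis less_nat_zero_code)
  then show "finite {m. m ` M \<subseteq> {..k} \<and> {g. m g \<noteq> 0} \<subseteq> M}"
    using finite_set_of_finite_funs[OF assms, of "{..k}" 0] by simp
qed

lemma count_vectors_nonempty:
  assumes "finite M" "M \<noteq> {}"
  shows "count_vectors M k \<noteq> {}"
proof -
  from assms(2) obtain h where "h \<in> M" by auto
  then have "(\<lambda>g. if g = h then k else 0) \<in> count_vectors M k"
    using assms(1) by (auto simp: count_vectors_def)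
  then show ?thesis by blast
qed

lemma abel_incr:
  fixes d y :: "nat \<Rightarrow> real"
  assumes "k \<ge> 1"
  shows "(\<Sum>l = 1..k. d l * y l) =
    d k * (\<Sum>l = 1..k. y l) + (\<Sum>t = 1..<k. (d t - d (t + 1)) * (\<Sum>l = 1..t. y l))"
  using assms by (induction k rule: dec_induct) (simp_all add: algebra_simps)

lemma sum_trunc: "0 \<le> x \<Longrightarrow> (\<Sum>l = 1..t. max 0 (min 1 (x - real (l - 1)))) = min x (real t)"
  for x :: real
  by (induction t) auto

lemma ext_curve_eq_sum:
  assumes "k \<ge> 1" "0 \<le> x" "x \<le> real k"
  shows "ext_curve psi k x = (\<Sum>l = 1..k. incr psi l * max 0 (min 1 (x - real (l - 1))))"
  unfolding abel_incr[OF assms(1)] sum_trunc[OF assms(2)] ext_curve_def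
  using assms by simp

lemma ext_curve_of_nat:
  assumes "k \<ge> 1" "r \<le> k" "psi 0 = 0"
  shows "ext_curve psi k (real r) = psi r"
proof -
  have "ext_curve psi k (real r) = (\<Sum>l = 1..k. incr psi l * (if l \<le> r then 1 else 0))"
    unfolding ext_curve_eq_sum[OF assms(1) of_nat_0_le_iff of_nat_mono[OF assms(2)]]
    by (intro sum.cong) auto
  also have "\<dots> = (\<Sum>l = 1..r. incr psi l)"
    using assms(2) by (intro sum.mono_neutral_cong_right) auto
  also have "\<dots> = psi r"
    using assms(3) by (induction r) (auto simp: incr_def)
  finally show ?thesis .
qed

lemma lp_objective_le:
  assumes "k \<ge> 1" "\<forall>t\<in>{1..<k}. incr psi (t + 1) \<le> incr psi t" "0 \<le> incr psi k"
    and f: "lp_feasible n M a k z y"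
  shows "lp_objective n M c \<gamma> psi k z y \<le> frac_F n M a c \<gamma> psi k z"
proof -
  have "(\<Sum>l = 1..k. incr psi l * y i l) \<le> ext_curve psi k (frac_correct M a i z)"
    if i: "i \<in> {1..n}" for i
  proof -
    have S: "(\<Sum>l = 1..t. y i l) \<le> min (frac_correct M a i z) (real t)" if "t \<le> k" for t
    proof -
      have "(\<Sum>l = 1..t. y i l) \<le> (\<Sum>l = 1..k. y i l)"
        using f i that by (intro sum_mono2) (auto simp: lp_feasible_def)
      also have "\<dots> \<le> frac_correct M a i z"
        using f i by (auto simp: lp_feasible_def frac_correct_def)
      finally have "(\<Sum>l = 1..t. y i l) \<le> frac_correct M a i z" .
      moreover have "(\<Sum>l = 1..t. y i l) \<le> (\<Sum>l = 1..t. 1)"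
        using f i that by (intro sum_mono) (auto simp: lp_feasible_def)
      ultimately show ?thesis by simp
    qed
    show ?thesis
      unfolding abel_incr[OF assms(1)] ext_curve_def
    proof (intro add_mono sum_mono mult_left_mono)
      show "(\<Sum>l = 1..k. y i l) \<le> frac_correct M a i z" using S[of k] by simp
    qed (use assms S in auto)
  qed
  then show ?thesis
    unfolding lp_objective_def frac_F_def frac_Q_def frac_C_def
    by (intro diff_right_mono mult_left_mono sum_mono) auto
qed

lemma lp_objective_attained:
  assumes "k \<ge> 1" "\<forall>i\<in>{1..n}. \<forall>g\<in>M. a i g \<in> {0, 1}" "frac_feasible M k z"
  shows "\<exists>y. lp_feasible n M a k z y \<and> lp_objective n M c \<gamma> psi k z y = frac_F n M a c \<gamma> psi k z"
proof -
  let ?x = "\<lambda>i. frac_correct M a i z"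
  define y where "y = (\<lambda>i l. max 0 (min 1 (?x i - real (l - 1))))"
  have x: "0 \<le> ?x i" "?x i \<le> real k" if "i \<in> {1..n}" for i
  proof -
    show "0 \<le> ?x i"
      using assms(3) by (auto simp: frac_correct_def frac_feasible_def intro: sum_nonneg)
    have "?x i \<le> (\<Sum>g\<in>M. z g)"
      unfolding frac_correct_def using assms(2,3) that
      by (intro sum_mono) (fastforce simp: frac_feasible_def)
    then show "?x i \<le> real k" using assms(3) by (simp add: frac_feasible_def)
  qed
  have "lp_feasible n M a k z y"
    unfolding lp_feasible_def
  proof (intro conjI ballI)
    fix i assume i: "i \<in> {1..n}"
    show "(\<Sum>l = 1..k. y i l) \<le> (\<Sum>g\<in>M. real (a i g) * z g)"
      unfolding y_def sum_trunc[OF x(1)[OF i]] by (simp add: frac_correct_def)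
  qed (use assms(3) in \<open>auto simp: frac_feasible_def y_def\<close>)
  moreover have "lp_objective n M c \<gamma> psi k z y = frac_F n M a c \<gamma> psi k z"
    unfolding lp_objective_def frac_F_def frac_Q_def frac_C_def
    using x by (simp add: ext_curve_eq_sum[OF assms(1)] y_def del: One_nat_def)
  ultimately show ?thesis by blast
qed

text \<open>Optimising out \<open>y\<close>: the LP is the maximisation of \<open>frac_F\<close> over feasible \<open>z\<close>.\<close>

lemma lp_optimal_iff:
  assumes "k \<ge> 1" "\<forall>i\<in>{1..n}. \<forall>g\<in>M. a i g \<in> {0, 1}"
    and "\<forall>t\<in>{1..<k}. incr psi (t + 1) \<le> incr psi t" "0 \<le> incr psi k"
  shows "(\<exists>y. lp_optimal n M a c \<gamma> psi k z y) \<longleftrightarrow>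
    frac_feasible M k z \<and>
    (\<forall>z'. frac_feasible M k z' \<longrightarrow> frac_F n M a c \<gamma> psi k z' \<le> frac_F n M a c \<gamma> psi k z)"
proof -
  let ?F = "frac_F n M a c \<gamma> psi k" and ?L = "lp_objective n M c \<gamma> psi k"
    and ?lp = "lp_feasible n M a k"
  have le: "?L z y \<le> ?F z" if "?lp z y" for z y
    using lp_objective_le[OF assms(1,3,4) that] .
  have att: "\<exists>y. ?lp z y \<and> ?L z y = ?F z" if "frac_feasible M k z" for z
    using lp_objective_attained[OF assms(1,2) that] .
  have feas: "frac_feasible M k z" if "?lp z y" for z y
    using that by (auto simp: lp_feasible_def frac_feasible_def)
  show ?thesis
  proof
    assume "\<exists>y. lp_optimal n M a c \<gamma> psi k z y"
    then obtain y where y: "?lp z y" "\<And>z' y'. ?lp z' y' \<Longrightarrow> ?L z' y' \<le> ?L z y"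
      unfolding lp_optimal_def by blast
    have "?F z' \<le> ?F z" if z': "frac_feasible M k z'" for z'
    proof -
      obtain y' where y': "?lp z' y'" "?L z' y' = ?F z'"
        using att[OF z'] by blast
      show ?thesis
        using y(2)[OF y'(1)] le[OF y(1)] y'(2) by linarith
    qed
    with feas[OF y(1)]
    show "frac_feasible M k z \<and> (\<forall>z'. frac_feasible M k z' \<longrightarrow> ?F z' \<le> ?F z)"
      by blast
  next
    assume z: "frac_feasible M k z \<and> (\<forall>z'. frac_feasible M k z' \<longrightarrow> ?F z' \<le> ?F z)"
    then obtain y where y: "?lp z y" "?L z y = ?F z"
      using att[of z] by blast
    have "?L z' y' \<le> ?L z y" if "?lp z' y'" for z' y'
    proof -
      have "?F z' \<le> ?F z"
        using z feas[OF that] by blast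
      with le[OF that] y(2) show ?thesis by linarith
    qed
    with y(1) show "\<exists>y. lp_optimal n M a c \<gamma> psi k z y"
      unfolding lp_optimal_def by blast
  qed
qed

end

theory Submission
  imports Defs
begin

text \<open>
  The extended curve is a nonnegative combination of the identity, with weight \<open>incr psi k\<close>, and of
  the truncations \<open>x \<mapsto> min x t\<close> with \<open>t \<ge> 1\<close>. Rounding preserves the mean, so it loses nothing on the
  identity, and the claim reduces to \<open>E (min X t) \<ge> (1 - 1/e) * min (E X) t\<close> for the
  number \<open>X\<close> of correct draws. For this, throw \<open>X\<close> balls independently into \<open>t\<close> bins: given \<open>X = r\<close>, the
  expected number \<open>t * (1 - (1 - 1/t)^r)\<close> of occupied bins is at most \<open>min r t\<close>, while its
  average over \<open>X\<close> factorises over the independent draws.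
\<close>

section \<open>Scalar inequalities behind the constant\<close>

text \<open>By concavity, \<open>1 - exp (- u)\<close> lies on \<open>[0, 1]\<close> above its chord
  from the origin, whose slope is \<open>1 - 1 / exp 1\<close>; beyond 1 monotonicity suffices. This
  is the source of the constant.\<close>

lemma one_minus_exp_ge:
  fixes u :: real
  assumes "0 \<le> u"
  shows "(1 - 1 / exp 1) * min u 1 \<le> 1 - exp (- u)"
proof (cases "u \<le> 1")
  case True
  have "exp ((1 - u) *\<^sub>R 0 + u *\<^sub>R (- 1)) \<le> (1 - u) * exp 0 + u * exp (- 1 :: real)"
    using assms True by (intro convex_onD[OF exp_convex]) auto
  then show ?thesis
    using True by (simp add: exp_minus field_simps)
next
  case False
  then have "exp (- u) \<le> exp (- 1)" by simp
  then show ?thesis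
    using False by (simp add: exp_minus field_simps)
qed

text \<open>Bernoulli's inequality gives the bound by \<open>real r\<close>; nonnegativity of the
  power gives the bound by \<open>real t\<close>.\<close>

lemma occupied_bins_le_min:
  assumes "t \<ge> 1"
  shows "real t * (1 - (1 - 1 / real t) ^ r) \<le> min (real r) (real t)"
proof -
  have "1 + real r * (- (1 / real t)) \<le> (1 + - (1 / real t)) ^ r"
    using assms by (intro Bernoulli_inequality) (simp add: field_simps)
  then have "real t * (1 - (1 - 1 / real t) ^ r) \<le> real t * (real r / real t)"
    by (intro mult_left_mono) auto
  moreover have "real t * (1 - (1 - 1 / real t) ^ r) \<le> real t * 1"
    using assms by (intro mult_left_mono) auto
  ultimately show ?thesis
    using assms by simp
qed

section \<open>Expectations over independent draws\<close>

lemma finite_set_Pi_pmf: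
  assumes "finite A" "\<And>x. x \<in> A \<Longrightarrow> finite (set_pmf (p x))"
  shows "finite (set_pmf (Pi_pmf A d p))"
  using assms by (simp add: set_Pi_pmf finite_PiE_dflt)

lemma expectation_sum_Pi_pmf:
  fixes f :: "'a \<Rightarrow> 'b \<Rightarrow> real"
  assumes "finite A" "\<And>x. x \<in> A \<Longrightarrow> finite (set_pmf (p x))"
  shows "measure_pmf.expectation (Pi_pmf A d p) (\<lambda>G. \<Sum>x\<in>A. f x (G x))
    = (\<Sum>x\<in>A. measure_pmf.expectation (p x) (f x))"
proof -
  have "measure_pmf.expectation (Pi_pmf A d p) (\<lambda>G. f x (G x)) = measure_pmf.expectation (p x) (f x)"
    if "x \<in> A" for x
    using integral_map_pmf[of "\<lambda>G. G x" "Pi_pmf A d p" "f x"] that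
    by (simp add: Pi_pmf_component[OF assms(1)])
  then show ?thesis
    by (subst Bochner_Integration.integral_sum)
       (auto intro!: integrable_measure_pmf_finite finite_set_Pi_pmf assms)
qed

text \<open>With \<open>q = 1 - 1 / t\<close>, \<open>q ^ r\<close> is the chance that a fixed bin
  stays empty after \<open>r\<close> balls. Independence and \<open>1 - v <= exp (- v)\<close> bound
  its mean by \<open>exp (- (x / t))\<close>, and \<open>one_minus_exp_ge\<close> at
  \<open>u = x / t\<close> brings in the constant.\<close>

lemma expectation_min_draws_ge:
  fixes a :: "'a \<Rightarrow> nat"
  assumes "k \<ge> 1" "t \<ge> 1" and fin: "finite (set_pmf p)"
    and a: "\<And>g. g \<in> set_pmf p \<Longrightarrow> a g \<in> {0, 1}"
  defines "x \<equiv> real k * measure_pmf.expectation p (\<lambda>g. real (a g))"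
  shows "(1 - 1 / exp 1) * min x (real t)
    \<le> measure_pmf.expectation (Pi_pmf {1..k} d (\<lambda>_. p)) (\<lambda>G. min (real (\<Sum>j = 1..k. a (G j))) (real t))"
proof -
  define q where "q = 1 - 1 / real t"
  define P where "P = Pi_pmf {1..k} d (\<lambda>_. p)"
  have q: "0 \<le> q" using assms(2) by (simp add: q_def)
  note [intro!] = integrable_measure_pmf_finite fin
  have finP: "finite (set_pmf P)"
    unfolding P_def by (intro finite_set_Pi_pmf) auto
  have mean: "0 \<le> x / real k" "x / real k \<le> 1"
  proof -
    have "measure_pmf.expectation p (\<lambda>g. real (a g)) \<le> measure_pmf.expectation p (\<lambda>g. 1)"
      using a by (intro integral_mono_AE) (fastforce simp: AE_measure_pmf_iff)+
    then show "x / real k \<le> 1" using assms(1) by (simp add: x_def)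
    show "0 \<le> x / real k" using assms(1) by (simp add: x_def)
  qed
  \<comment> \<open>A 0-1 exponent makes \<open>q ^ a g\<close> affine in \<open>a g\<close>, so its
    expectation depends only on the mean.\<close>
  have "measure_pmf.expectation p (\<lambda>g. q ^ a g)
      = measure_pmf.expectation p (\<lambda>g. 1 - real (a g) / real t)"
    using a by (intro integral_cong_AE) (fastforce simp: AE_measure_pmf_iff q_def)+
  also have "\<dots> = 1 - x / real k / real t"
    using assms(1) by (subst Bochner_Integration.integral_diff) (auto simp: x_def)
  finally have one: "measure_pmf.expectation p (\<lambda>g. q ^ a g) = 1 - x / real k / real t" .
  \<comment> \<open>The power of a sum is a product over the draws, so independence yields a
    \<open>k\<close>-th power.\<close>
  have "measure_pmf.expectation P (\<lambda>G. q ^ (\<Sum>j = 1..k. a (G j))) = (1 - x / real k / real t) ^ k"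
    unfolding P_def power_sum using q
    by (subst expectation_prod_Pi_pmf) (auto simp: one)
  also have "\<dots> \<le> exp (- (x / real k / real t)) ^ k"
  proof (rule power_mono)
    show "1 - x / real k / real t \<le> exp (- (x / real k / real t))"
      using exp_ge_add_one_self[of "- (x / real k / real t)"] by simp
    \<comment> \<open>Monotonicity of the power needs a nonnegative base, which holds since
      \<open>x / k <= 1 <= t\<close>.\<close>
    have "x / real k \<le> 1 * real t"
      using mean(2) assms(2) by linarith
    then show "0 \<le> 1 - x / real k / real t"
      using assms(2) by (simp only: pos_divide_le_eq diff_ge_0_iff_ge of_nat_0_less_iff)
  qed
  also have "\<dots> = exp (- (x / real t))"
    using assms(1) by (simp add: exp_of_nat_mult[symmetric])
  finally have gen: "measure_pmf.expectation P (\<lambda>G. q ^ (\<Sum>j = 1..k. a (G j))) \<le> exp (- (x / real t))" .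
  \<comment> \<open>Rescaling by \<open>t\<close> moves the truncation level to 1.\<close>
  have "(1 - 1 / exp 1) * min x (real t) = real t * ((1 - 1 / exp 1) * min (x / real t) 1)"
    using assms(2) by (auto simp: min_def field_simps)
  also have "\<dots> \<le> real t * (1 - exp (- (x / real t)))"
    using mean(1) assms(1,2) by (intro mult_left_mono one_minus_exp_ge) (auto simp: zero_le_divide_iff)
  also have "\<dots> \<le> real t * (1 - measure_pmf.expectation P (\<lambda>G. q ^ (\<Sum>j = 1..k. a (G j))))"
    using gen by (intro mult_left_mono) auto
  also have "\<dots> = measure_pmf.expectation P (\<lambda>G. real t * (1 - q ^ (\<Sum>j = 1..k. a (G j))))"
    using finP by (simp add: integrable_measure_pmf_finite)
  also have "\<dots> \<le> measure_pmf.expectation P (\<lambda>G. min (real (\<Sum>j = 1..k. a (G j))) (real t))"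
    unfolding q_def using finP assms(2)
    by (intro integral_mono integrable_measure_pmf_finite occupied_bins_le_min)
  finally show ?thesis unfolding P_def .
qed

section \<open>Bounds for the extended curve\<close>

text \<open>Replacing each \<open>min x t\<close> by \<open>x\<close> leaves weights that telescope
  to \<open>incr psi 1\<close>.\<close>

lemma ext_curve_le_linear:
  assumes "k \<ge> 1" "\<forall>t\<in>{1..<k}. incr psi (t + 1) \<le> incr psi t"
  shows "ext_curve psi k x \<le> incr psi 1 * x"
proof -
  have "ext_curve psi k x \<le> incr psi k * x + (\<Sum>t = 1..<k. (incr psi t - incr psi (t + 1)) * x)"
    unfolding ext_curve_def using assms(2) by (intro add_left_mono sum_mono mult_left_mono) auto
  also have "(\<Sum>t = 1..<k. (incr psi t - incr psi (t + 1)) * x) = (incr psi 1 - incr psi k) * x"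
    using sum_Suc_diff'[OF assms(1), of "\<lambda>t. - incr psi t"]
    by (simp flip: sum_distrib_right)
  finally show ?thesis by (simp add: algebra_simps)
qed

text \<open>Concavity makes the weights of the truncations nonnegative, so
  \<open>expectation_min_draws_ge\<close> applies term by term, while the linear part has exact
  mean.\<close>

lemma expectation_ext_curve_ge:
  fixes a :: "'a \<Rightarrow> nat"
  assumes "k \<ge> 1" and fin: "finite (set_pmf p)"
    and a: "\<And>g. g \<in> set_pmf p \<Longrightarrow> a g \<in> {0, 1}"
    and conc: "\<forall>t\<in>{1..<k}. incr psi (t + 1) \<le> incr psi t"
  defines "x \<equiv> real k * measure_pmf.expectation p (\<lambda>g. real (a g))"
  shows "(1 - 1 / exp 1) * ext_curve psi k x + incr psi k / exp 1 * x
    \<le> measure_pmf.expectation (Pi_pmf {1..k} d (\<lambda>_. p)) (\<lambda>G. ext_curve psi k (real (\<Sum>j = 1..k. a (G j))))"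
proof -
  let ?E = "measure_pmf.expectation (Pi_pmf {1..k} d (\<lambda>_. p))"
  let ?X = "\<lambda>G. real (\<Sum>j = 1..k. a (G j))"
  have int: "integrable (Pi_pmf {1..k} d (\<lambda>_. p)) f" for f :: "_ \<Rightarrow> real"
    using fin by (intro integrable_measure_pmf_finite finite_set_Pi_pmf) auto
  have EX: "?E ?X = x"
    using expectation_sum_Pi_pmf[of "{1..k}" "\<lambda>_. p" d "\<lambda>_ g. real (a g)"] fin by (simp add: x_def)
  \<comment> \<open>The extra term tops up the linear part from the factor
    \<open>1 - 1 / exp 1\<close> to 1; only the truncations keep the discount.\<close>
  have "(1 - 1 / exp 1) * ext_curve psi k x + incr psi k / exp 1 * x
      = incr psi k * x
        + (\<Sum>t = 1..<k. (incr psi t - incr psi (t + 1)) * ((1 - 1 / exp 1) * min x (real t)))"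
    unfolding ext_curve_def by (simp add: algebra_simps sum_distrib_left)
  also have "\<dots> \<le> incr psi k * x
        + (\<Sum>t = 1..<k. (incr psi t - incr psi (t + 1)) * ?E (\<lambda>G. min (?X G) (real t)))"
    unfolding x_def using conc assms(1) fin a
    by (intro add_left_mono sum_mono mult_left_mono expectation_min_draws_ge) auto
  also have "\<dots> = ?E (\<lambda>G. ext_curve psi k (?X G))"
    unfolding ext_curve_def
    by (simp only: Bochner_Integration.integral_add[OF int int] Bochner_Integration.integral_sum[OF int]
        integral_mult_right_zero EX)
  finally show ?thesis .
qed

section \<open>From count vectors to draws\<close>

text \<open>Double counting of the draws by their type. A general semiring covers both the
  natural-number \<open>num_correct\<close> and the real costs.\<close>

lemma sum_counts:
  fixes f :: "'g \<Rightarrow> 'b::semiring_1"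
  assumes "finite M" "\<forall>j\<in>J. G j \<in> M"
  shows "(\<Sum>g\<in>M. f g * of_nat (\<Sum>j\<in>J. if G j = g then 1 else 0)) = (\<Sum>j\<in>J. f (G j))"
proof -
  have "(\<Sum>g\<in>M. f g * of_nat (\<Sum>j\<in>J. if G j = g then 1 else 0))
      = (\<Sum>j\<in>J. \<Sum>g\<in>M. if G j = g then f g else 0)"
    by (subst sum.swap) (auto simp: sum_distrib_left intro!: sum.cong)
  also have "\<dots> = (\<Sum>j\<in>J. f (G j))"
    using assms by (intro sum.cong) auto
  finally show ?thesis .
qed

lemma set_draw_pmf:
  assumes "finite M" "k > 0" "frac_feasible M k z"
  shows "set_pmf (draw_pmf M k z) \<subseteq> M"
  using assms by (auto simp: set_pmf_iff pmf_draw_pmf split: if_splits)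

text \<open>The factor \<open>k\<close> undoes the normalisation of \<open>z\<close>, so
  \<open>frac_correct\<close> and \<open>frac_C\<close> become \<open>k\<close> times one-draw
  means.\<close>

lemma expectation_draw_pmf:
  fixes f :: "'g \<Rightarrow> real"
  assumes "finite M" "k > 0" "frac_feasible M k z"
  shows "real k * measure_pmf.expectation (draw_pmf M k z) f = (\<Sum>g\<in>M. f g * z g)"
proof -
  have "measure_pmf.expectation (draw_pmf M k z) f = (\<Sum>g\<in>M. f g * pmf (draw_pmf M k z) g)"
    using assms set_draw_pmf by (intro integral_measure_pmf_real) auto
  then show ?thesis
    using assms by (simp add: pmf_draw_pmf sum_distrib_left)
qed

text \<open>Pulled back to the draws, each task contributes an expectation bounded by
  \<open>expectation_ext_curve_ge\<close>, and the cost has exact mean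
  \<open>frac_C\<close>.\<close>

lemma expected_profit_ge:
  fixes M :: "'g set"
  assumes k: "k \<ge> 1" and M: "finite M"
    and a: "\<forall>i\<in>{1..n}. \<forall>g\<in>M. a i g \<in> {0, 1}"
    and psi0: "psi 0 = 0"
    and conc: "\<forall>l\<in>{1..<k}. incr psi (l + 1) \<le> incr psi l"
    and z: "frac_feasible M k z"
  shows "(1 - 1 / exp 1) * frac_Q n M a psi k z + incr psi k / exp 1 * frac_R n M a z
      - \<gamma> * frac_C M c z \<le> expected_profit n M a c \<gamma> psi k z"
proof -
  let ?p = "draw_pmf M k z"
  let ?P = "Pi_pmf {1..k} undefined (\<lambda>_. ?p)"
  let ?E = "measure_pmf.expectation ?P"
  let ?x = "\<lambda>i. frac_correct M a i z"
  have k0: "k > 0" using k by simp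
  have sub: "set_pmf ?p \<subseteq> M" using set_draw_pmf[OF M k0 z] .
  have fin: "finite (set_pmf ?p)" using finite_subset[OF sub M] .
  have int: "integrable ?P f" for f :: "_ \<Rightarrow> real"
    using fin by (intro integrable_measure_pmf_finite finite_set_Pi_pmf) auto
  have draws: "\<forall>j\<in>{1..k}. G j \<in> M" if "G \<in> set_pmf ?P" for G
    using that sub by (fastforce simp: set_Pi_pmf PiE_dflt_def)
  have "profit n M a c \<gamma> psi (\<lambda>g. \<Sum>j = 1..k. if G j = g then 1 else 0)
      = (1 / real n) * (\<Sum>i = 1..n. ext_curve psi k (real (\<Sum>j = 1..k. a i (G j))))
        - \<gamma> * (\<Sum>j = 1..k. c (G j))" if G: "G \<in> set_pmf ?P" for G
  proof -
    \<comment> \<open>At most \<open>k\<close> draws are correct, so on the support the extended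
      curve may replace \<open>psi\<close>.\<close>
    have "ext_curve psi k (real (\<Sum>j = 1..k. a i (G j))) = psi (\<Sum>j = 1..k. a i (G j))"
      if "i \<in> {1..n}" for i
    proof (rule ext_curve_of_nat[where psi = psi, OF k _ psi0])
      have "(\<Sum>j = 1..k. a i (G j)) \<le> (\<Sum>j = 1..k. 1)"
        using a draws[OF G] that by (intro sum_mono) fastforce
      then show "(\<Sum>j = 1..k. a i (G j)) \<le> k" by simp
    qed
    moreover have "num_correct M a i (\<lambda>g. \<Sum>j = 1..k. if G j = g then 1 else 0)
        = (\<Sum>j = 1..k. a i (G j))" for i
      using sum_counts[OF M draws[OF G], of "a i"] by (simp add: num_correct_def)
    ultimately show ?thesis
      unfolding profit_def sum_counts[OF M draws[OF G], of c] by simp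
  qed
  then have "expected_profit n M a c \<gamma> psi k z
      = ?E (\<lambda>G. (1 / real n) * (\<Sum>i = 1..n. ext_curve psi k (real (\<Sum>j = 1..k. a i (G j))))
          - \<gamma> * (\<Sum>j = 1..k. c (G j)))"
    unfolding expected_profit_def rounding_pmf_def integral_map_pmf
    by (intro integral_cong_AE) (auto simp: AE_measure_pmf_iff)
  also have "\<dots> = (1 / real n) * (\<Sum>i = 1..n. ?E (\<lambda>G. ext_curve psi k (real (\<Sum>j = 1..k. a i (G j)))))
      - \<gamma> * ?E (\<lambda>G. \<Sum>j = 1..k. c (G j))"
    by (simp only: Bochner_Integration.integral_diff[OF int int]
        Bochner_Integration.integral_sum[OF int] integral_mult_right_zero)
  also have "?E (\<lambda>G. \<Sum>j = 1..k. c (G j)) = frac_C M c z"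
    using expectation_sum_Pi_pmf[of "{1..k}" "\<lambda>_. ?p" undefined "\<lambda>_. c"] fin
    by (simp add: frac_C_def expectation_draw_pmf[OF M k0 z])
  finally have eq: "expected_profit n M a c \<gamma> psi k z
      = (1 / real n) * (\<Sum>i = 1..n. ?E (\<lambda>G. ext_curve psi k (real (\<Sum>j = 1..k. a i (G j)))))
        - \<gamma> * frac_C M c z" .
  have "(1 - 1 / exp 1) * ext_curve psi k (?x i) + incr psi k / exp 1 * ?x i
      \<le> ?E (\<lambda>G. ext_curve psi k (real (\<Sum>j = 1..k. a i (G j))))" if "i \<in> {1..n}" for i
    unfolding frac_correct_def expectation_draw_pmf[OF M k0 z, symmetric]
    using a sub that by (intro expectation_ext_curve_ge[OF k fin _ conc]) blast
  then have "(1 / real n) * (\<Sum>i = 1..n. (1 - 1 / exp 1) * ext_curve psi k (?x i) + incr psi k / exp 1 * ?x i)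
      \<le> (1 / real n) * (\<Sum>i = 1..n. ?E (\<lambda>G. ext_curve psi k (real (\<Sum>j = 1..k. a i (G j)))))"
    by (intro mult_left_mono sum_mono) auto
  moreover have "(1 / real n) * (\<Sum>i = 1..n. (1 - 1 / exp 1) * ext_curve psi k (?x i) + incr psi k / exp 1 * ?x i)
      = (1 - 1 / exp 1) * frac_Q n M a psi k z + incr psi k / exp 1 * frac_R n M a z"
    unfolding frac_Q_def frac_R_def sum.distrib
    by (simp only: sum_distrib_left[symmetric] distrib_left mult.left_commute)
  ultimately show ?thesis
    unfolding eq by linarith
qed

section \<open>Curvature and the LP relaxation\<close>

text \<open>Lets \<open>frac_R\<close> be traded for \<open>frac_Q\<close> in the curvature
  bound.\<close>

lemma frac_Q_le_frac_R:
  assumes "k \<ge> 1" "\<forall>t\<in>{1..<k}. incr psi (t + 1) \<le> incr psi t"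
  shows "frac_Q n M a psi k z \<le> incr psi 1 * frac_R n M a z"
proof -
  have "frac_Q n M a psi k z \<le> (1 / real n) * (\<Sum>i = 1..n. incr psi 1 * frac_correct M a i z)"
    unfolding frac_Q_def by (intro mult_left_mono sum_mono ext_curve_le_linear assms) auto
  then show ?thesis
    unfolding frac_R_def by (simp add: sum_distrib_left mult.left_commute)
qed

lemma profit_eq_frac_F:
  assumes k: "k \<ge> 1" and M: "finite M"
    and a: "\<forall>i\<in>{1..n}. \<forall>g\<in>M. a i g \<in> {0, 1}"
    and psi0: "psi 0 = 0" and m: "m \<in> count_vectors M k"
  shows "profit n M a c \<gamma> psi m = frac_F n M a c \<gamma> psi k (\<lambda>g. real (m g))"
proof -
  have "ext_curve psi k (frac_correct M a i (\<lambda>g. real (m g))) = psi (num_correct M a i m)"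
    if "i \<in> {1..n}" for i
  proof -
    have "num_correct M a i m \<le> (\<Sum>g\<in>M. m g)"
      unfolding num_correct_def using a that by (intro sum_mono) fastforce
    then have "num_correct M a i m \<le> k"
      using m by (simp add: count_vectors_def)
    moreover have "frac_correct M a i (\<lambda>g. real (m g)) = real (num_correct M a i m)"
      by (simp add: frac_correct_def num_correct_def)
    ultimately show ?thesis
      using ext_curve_of_nat[where psi = psi, OF k _ psi0] by simp
  qed
  then show ?thesis
    by (simp add: profit_def frac_F_def frac_Q_def frac_C_def)
qed

text \<open>Relaxation: every count vector is a feasible fractional vector of the same value, so a
  bound on \<open>frac_F\<close> also bounds the finite maximum.\<close>

lemma opt_profit_le_frac_F:
  assumes k: "k \<ge> 1" and M: "finite M" "M \<noteq> {}"
    and a: "\<forall>i\<in>{1..n}. \<forall>g\<in>M. a i g \<in> {0, 1}" and psi0: "psi 0 = 0"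
    and opt: "\<And>z'. frac_feasible M k z' \<Longrightarrow> frac_F n M a c \<gamma> psi k z' \<le> b"
  shows "opt_profit n M a c \<gamma> psi k \<le> b"
proof -
  have "profit n M a c \<gamma> psi m \<le> b" if m: "m \<in> count_vectors M k" for m
  proof -
    have "frac_feasible M k (\<lambda>g. real (m g))"
      using m by (simp add: frac_feasible_def count_vectors_def flip: of_nat_sum)
    from opt[OF this] show ?thesis
      by (simp add: profit_eq_frac_F[where psi = psi, OF k M(1) a psi0 m])
  qed
  then show ?thesis
    unfolding opt_profit_def
    using finite_count_vectors[OF M(1)] count_vectors_nonempty[OF M] by simp
qed

theorem theorem3:
  fixes n k :: nat
    and M :: "'g set"
    and a :: "nat \<Rightarrow> 'g \<Rightarrow> nat"
    and c :: "'g \<Rightarrow> real"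
    and \<gamma> :: real
    and psi :: "nat \<Rightarrow> real"
    and z :: "'g \<Rightarrow> real"
  assumes "n \<ge> 1" and "k \<ge> 1"
    and "finite M" and "M \<noteq> {}"
    and "\<forall>i\<in>{1..n}. \<forall>g\<in>M. a i g \<in> {0, 1}"
    and "\<forall>g\<in>M. c g \<ge> 0" and "\<gamma> \<ge> 0"
    and "\<forall>l\<in>{0..k}. psi l \<in> {0..1}" and "psi 0 = 0" and "psi k = 1"
    and "\<forall>l\<in>{1..<k}. incr psi (l + 1) \<le> incr psi l"
    and "incr psi k \<ge> 0" and "incr psi 1 > 0"
    and "frac_feasible M k z"
  shows
    "expected_profit n M a c \<gamma> psi k z
       \<ge> (1 - 1 / exp 1) * frac_Q n M a psi k z + incr psi k / exp 1 * frac_R n M a z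
           - \<gamma> * frac_C M c z
     \<and> frac_F n M a c \<gamma> psi k z - expected_profit n M a c \<gamma> psi k z
         \<le> 1 / exp 1 * (frac_Q n M a psi k z - incr psi k * frac_R n M a z)
     \<and> 1 / exp 1 * (frac_Q n M a psi k z - incr psi k * frac_R n M a z)
         \<le> curvature psi k / exp 1 * frac_Q n M a psi k z
     \<and> ((\<exists>y. lp_optimal n M a c \<gamma> psi k z y) \<longrightarrow>
          opt_profit n M a c \<gamma> psi k - expected_profit n M a c \<gamma> psi k z
            \<le> 1 / exp 1 * (frac_Q n M a psi k z - incr psi k * frac_R n M a z)
          \<and> 1 / exp 1 * (frac_Q n M a psi k z - incr psi k * frac_R n M a z)
            \<le> curvature psi k / exp 1 * frac_Q n M a psi k z)"
proof -
  let ?Q = "frac_Q n M a psi k z" and ?R = "frac_R n M a z" and ?C = "frac_C M c z"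
  let ?gap = "1 / exp 1 * (?Q - incr psi k * ?R)"
  have lower: "(1 - 1 / exp 1) * ?Q + incr psi k / exp 1 * ?R - \<gamma> * ?C
      \<le> expected_profit n M a c \<gamma> psi k z"
    using assms by (intro expected_profit_ge) auto
  \<comment> \<open>The costs cancel, and a share \<open>1 / exp 1\<close> of \<open>frac_Q\<close>
    remains.\<close>
  then have gap: "frac_F n M a c \<gamma> psi k z - expected_profit n M a c \<gamma> psi k z \<le> ?gap"
    by (simp add: frac_F_def algebra_simps)
  have "?Q \<le> incr psi 1 * ?R"
    using assms by (intro frac_Q_le_frac_R) auto
  \<comment> \<open>The ratio is \<open>1 - curvature psi k\<close>, and the right side collapses to
    \<open>incr psi k\<close> times \<open>frac_R\<close>.\<close>
  then have "incr psi k / incr psi 1 * ?Q \<le> incr psi k / incr psi 1 * (incr psi 1 * ?R)"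
    using assms by (intro mult_left_mono) auto
  then have "?Q - incr psi k * ?R \<le> curvature psi k * ?Q"
    using \<open>incr psi 1 > 0\<close> by (simp add: curvature_def algebra_simps)
  then have curv: "?gap \<le> curvature psi k / exp 1 * ?Q"
    by (simp add: divide_right_mono)
  have "opt_profit n M a c \<gamma> psi k - expected_profit n M a c \<gamma> psi k z \<le> ?gap"
    if "\<exists>y. lp_optimal n M a c \<gamma> psi k z y"
  proof -
    \<comment> \<open>\<open>lp_optimal_iff\<close> eliminates \<open>y\<close>, so the value of
      \<open>frac_F\<close> at \<open>z\<close> bounds it at every feasible vector.\<close>
    have "opt_profit n M a c \<gamma> psi k \<le> frac_F n M a c \<gamma> psi k z"
      using that assms by (intro opt_profit_le_frac_F) (auto simp: lp_optimal_iff)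
    with gap show ?thesis by linarith
  qed
  with lower gap curv show ?thesis by blast
qed

end
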